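(* ($(p,q)$-binomial theorem.) Let $0<q<p$, let $a,b$ be nonzero complex numbers, and let $z\in\mathbb{C}$ with $|z|<1$ and $|az|<p$. Then $${}_1\Phi_0\big((a,b);-;(p,q),z\big)=\frac{((p,bz);(p,q))_\infty}{((p,az);(p,q))_\infty}.$$
   Context: For $n\ge 0$, $((a,b);(p,q))_n=\prod_{i=0}^{n-1}(ap^i-bq^i)$ (equal to $1$ for $n=0$). The series ${}_1\Phi_0$ is $${}_1\Phi_0((a,b);-;(p,q),z)=\sum_{n=0}^\infty\frac{((a,b);(p,q))_n}{((p,q);(p,q))_n}z^n.$$ A quotient of infinite products is understood as the limit of quotients of finite ones: $\frac{((a,b);(p,q))_\infty}{((c,d);(p,q))_\infty}=\lim_{N\to\infty}\frac{((a,b);(p,q))_N}{((c,d);(p,q))_N}$. *)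

theory Defs
  imports Complex_Main
begin

definition pq_poch :: "complex \<Rightarrow> complex \<Rightarrow> real \<Rightarrow> real \<Rightarrow> nat \<Rightarrow> complex" where
  "pq_poch a b p q n = (\<Prod>i<n. a * of_real p ^ i - b * of_real q ^ i)"

definition pq_Phi10_term :: "complex \<Rightarrow> complex \<Rightarrow> real \<Rightarrow> real \<Rightarrow> complex \<Rightarrow> nat \<Rightarrow> complex" where
  "pq_Phi10_term a b p q z n =
     pq_poch a b p q n / pq_poch (of_real p) (of_real q) p q n * z ^ n"

definition pq_Phi10 :: "complex \<Rightarrow> complex \<Rightarrow> real \<Rightarrow> real \<Rightarrow> complex \<Rightarrow> complex" where
  "pq_Phi10 a b p q z = (\<Sum>n. pq_Phi10_term a b p q z n)"

definition pq_poch_quot ::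
    "complex \<Rightarrow> complex \<Rightarrow> complex \<Rightarrow> complex \<Rightarrow> real \<Rightarrow> real \<Rightarrow> nat \<Rightarrow> complex" where
  "pq_poch_quot a b c d p q N = pq_poch a b p q N / pq_poch c d p q N"

text \<open>The two infinite products need not converge separately; only their quotient is
  given a meaning, as the limit of the quotients of finite products.\<close>

definition pq_poch_inf_quot ::
    "complex \<Rightarrow> complex \<Rightarrow> complex \<Rightarrow> complex \<Rightarrow> real \<Rightarrow> real \<Rightarrow> complex" where
  "pq_poch_inf_quot a b c d p q = lim (\<lambda>N. pq_poch_quot a b c d p q N)"

end

theory Submission
  imports Defs
begin

text \<open>
  The recurrence
  \<open>(p\<^sup>n\<^sup>+\<^sup>1 - q\<^sup>n\<^sup>+\<^sup>1) c\<^sub>n\<^sub>+\<^sub>1 = (a p\<^sup>n - b q\<^sup>n) c\<^sub>n\<close> of the coefficients of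
  \<open>F z = pq_Phi10 a b p q z\<close> is the same thing as the functional equation
  \<open>(p - a z) F z = (p - b z) F (z q / p)\<close> (lemma \<open>pq_Phi10_functional_eq\<close>).
  Iterating it \<open>N\<close> times produces exactly the \<open>N\<close>-th finite quotient of the right-hand side:
  \<open>F z\<close> equals that quotient times \<open>F (z (q/p)\<^sup>N)\<close> (lemma \<open>pq_Phi10_eq_quot_times\<close>).
  Since \<open>q < p\<close>, the argument \<open>z (q/p)\<^sup>N\<close> tends to \<open>0\<close>, and \<open>F\<close> is continuous there with
  \<open>F 0 = 1\<close>.  So the remaining factor tends to \<open>1\<close>, which yields both that the quotients
  converge and that their limit is \<open>F z\<close>; the infinite product needs no estimate of its own.
\<close>

definition pq_coeff :: "complex \<Rightarrow> complex \<Rightarrow> real \<Rightarrow> real \<Rightarrow> nat \<Rightarrow> complex" where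
  "pq_coeff a b p q n = pq_poch a b p q n / pq_poch (of_real p) (of_real q) p q n"

lemma pq_Phi10_term_eq: "pq_Phi10_term a b p q z = (\<lambda>n. pq_coeff a b p q n * z ^ n)"
  by (simp add: pq_Phi10_term_def pq_coeff_def fun_eq_iff)

lemma pq_coeff_0 [simp]: "pq_coeff a b p q 0 = 1"
  by (simp add: pq_coeff_def pq_poch_def)

lemma pq_denom_nonzero:
  fixes p q :: real
  assumes "0 < q" "q < p"
  shows "(of_real p :: complex) ^ Suc n - of_real q ^ Suc n \<noteq> 0"
proof -
  have "q ^ Suc n < p ^ Suc n"
    using assms by (intro power_strict_mono) auto
  then have "of_real (p ^ Suc n - q ^ Suc n) \<noteq> (0 :: complex)"
    by (simp only: of_real_eq_0_iff)
  then show ?thesis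
    by (simp only: of_real_diff of_real_power not_False_eq_True)
qed

lemma pq_coeff_Suc:
  "pq_coeff a b p q (Suc n) =
     pq_coeff a b p q n *
       ((a * of_real p ^ n - b * of_real q ^ n) / (of_real p ^ Suc n - of_real q ^ Suc n))"
  by (simp add: pq_coeff_def pq_poch_def)

lemma pq_coeff_ratio_tendsto:
  fixes p q :: real
  assumes "0 < q" "q < p"
  shows "(\<lambda>n. (a * of_real p ^ n - b * of_real q ^ n) / (of_real p ^ Suc n - of_real q ^ Suc n))
           \<longlonglongrightarrow> a / (of_real p :: complex)"
proof -
  define r :: complex where "r = of_real (q / p)"
  have "norm r < 1"
    using assms by (simp add: r_def norm_divide)
  then have r: "(\<lambda>n. r ^ n) \<longlonglongrightarrow> 0"
    by (rule LIMSEQ_power_zero)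
  have p: "(of_real p :: complex) \<noteq> 0"
    using assms by simp
  have "(\<lambda>n. (a - b * r ^ n) / (of_real p - of_real q * r ^ n))
          \<longlonglongrightarrow> (a - b * 0) / (of_real p - of_real q * 0)"
    by (intro tendsto_intros r) (use p in simp)
  moreover have "(a - b * r ^ n) / (of_real p - of_real q * r ^ n) =
      (a * of_real p ^ n - b * of_real q ^ n) / (of_real p ^ Suc n - of_real q ^ Suc n)" for n
  proof -
    have "of_real p ^ n * r ^ n = (of_real q ^ n :: complex)"
      using p by (simp add: r_def power_divide)
    then have "a * of_real p ^ n - b * of_real q ^ n = of_real p ^ n * (a - b * r ^ n)"
      and "of_real p ^ Suc n - of_real q ^ Suc n = of_real p ^ n * (of_real p - of_real q * r ^ n)"
      by (simp_all add: algebra_simps)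
    then show ?thesis
      using p by simp
  qed
  ultimately show ?thesis
    by simp
qed

lemma summable_pq_coeff:
  fixes p q :: real
  assumes "0 < q" "q < p" and "norm (a * z) < p"
  shows "summable (\<lambda>n. pq_coeff a b p q n * z ^ n)"
proof -
  let ?R = "\<lambda>n. (a * of_real p ^ n - b * of_real q ^ n) / (of_real p ^ Suc n - of_real q ^ Suc n)"
  have "norm (a / of_real p * z) < 1"
    using assms by (simp add: norm_mult norm_divide)
  then obtain k where k: "norm (a / of_real p * z) < k" "k < 1"
    using dense by blast
  have "(\<lambda>n. norm (?R n * z)) \<longlonglongrightarrow> norm (a / of_real p * z)"
    by (intro tendsto_intros pq_coeff_ratio_tendsto assms)
  then have "eventually (\<lambda>n. norm (?R n * z) < k) sequentially"
    using k(1) by (rule order_tendstoD)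
  then obtain N where N: "\<And>n. n \<ge> N \<Longrightarrow> norm (?R n * z) < k"
    by (auto simp: eventually_sequentially)
  show ?thesis
  proof (rule summable_ratio_test[OF k(2)])
    fix n assume "N \<le> n"
    have "norm (pq_coeff a b p q (Suc n) * z ^ Suc n) =
            norm (?R n * z) * norm (pq_coeff a b p q n * z ^ n)"
      unfolding pq_coeff_Suc norm_mult [symmetric] by (simp only: power_Suc mult_ac)
    also have "\<dots> \<le> k * norm (pq_coeff a b p q n * z ^ n)"
      using N[OF \<open>N \<le> n\<close>] by (intro mult_right_mono) auto
    finally show "norm (pq_coeff a b p q (Suc n) * z ^ Suc n)
        \<le> k * norm (pq_coeff a b p q n * z ^ n)" .
  qed
qed

text \<open>Multiplying the recurrence by \<open>z\<^sup>n\<^sup>+\<^sup>1 / p\<^sup>n\<close> turns the powers of \<open>q/p\<close> into a rescaling of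
  the argument.  Its left side is then \<open>p\<close> times the \<open>(n+1)\<close>-st term of \<open>F z - F (z q / p)\<close>,
  whose constant terms cancel, and its right side is the \<open>n\<close>-th term of
  \<open>a z F z - b z F (z q / p)\<close>.\<close>

lemma pq_Phi10_functional_eq:
  fixes p q :: real
  assumes pq: "0 < q" "q < p" and z: "norm (a * z) < p"
  shows "(of_real p - a * z) * pq_Phi10 a b p q z =
         (of_real p - b * z) * pq_Phi10 a b p q (z * of_real (q / p))"
proof -
  define r :: complex where "r = of_real (q / p)"
  define c where "c = pq_coeff a b p q"
  let ?F = "pq_Phi10 a b p q"
  have p: "(of_real p :: complex) \<noteq> 0"
    using pq by simp
  have "norm r \<le> 1"
    using pq by (simp add: r_def norm_divide)
  then have "norm (a * z) * norm r \<le> norm (a * z)"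
    by (simp add: mult_left_le)
  then have zr: "norm (a * (z * r)) < p"
    using z by (simp add: norm_mult mult.assoc)
  have sm: "(\<lambda>n. c n * w ^ n) sums ?F w" if "norm (a * w) < p" for w
    using summable_pq_coeff[OF pq that, of b]
    by (simp add: pq_Phi10_def pq_Phi10_term_eq c_def summable_sums)
  have step: "of_real p * (c (Suc n) * z ^ Suc n - c (Suc n) * (z * r) ^ Suc n) =
      a * z * (c n * z ^ n) - b * z * (c n * (z * r) ^ n)" for n
  proof -
    have rp: "r ^ m = of_real q ^ m / of_real p ^ m" for m
      by (simp add: r_def power_divide)
    have rec: "c (Suc n) * (of_real p ^ Suc n - of_real q ^ Suc n) =
        c n * (a * of_real p ^ n - b * of_real q ^ n)"
      using pq_denom_nonzero[OF pq, of n] unfolding c_def pq_coeff_Suc by simp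
    have "of_real p * (c (Suc n) * z ^ Suc n - c (Suc n) * (z * r) ^ Suc n) =
        c (Suc n) * (of_real p ^ Suc n - of_real q ^ Suc n) * (z ^ Suc n / of_real p ^ n)"
      unfolding power_mult_distrib rp using p by (simp add: field_simps)
    also have "\<dots> = a * z * (c n * z ^ n) - b * z * (c n * (z * r) ^ n)"
      unfolding rec power_mult_distrib rp using p by (simp add: field_simps)
    finally show ?thesis .
  qed
  have "(\<lambda>n. c n * z ^ n - c n * (z * r) ^ n) sums (?F z - ?F (z * r))"
    by (intro sums_diff sm z zr)
  then have "(\<lambda>n. c (Suc n) * z ^ Suc n - c (Suc n) * (z * r) ^ Suc n) sums (?F z - ?F (z * r))"
    by (subst sums_Suc_iff) simp
  then have "(\<lambda>n. a * z * (c n * z ^ n) - b * z * (c n * (z * r) ^ n))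
      sums (of_real p * (?F z - ?F (z * r)))"
    unfolding step [symmetric] by (rule sums_mult)
  moreover have "(\<lambda>n. a * z * (c n * z ^ n) - b * z * (c n * (z * r) ^ n))
      sums (a * z * ?F z - b * z * ?F (z * r))"
    by (intro sums_diff sums_mult sm z zr)
  ultimately have "of_real p * (?F z - ?F (z * r)) = a * z * ?F z - b * z * ?F (z * r)"
    by (rule sums_unique2)
  then show ?thesis
    unfolding r_def [symmetric] by (simp add: algebra_simps)
qed

lemma pq_Phi10_eq_quot_times:
  fixes p q :: real
  assumes pq: "0 < q" "q < p" and z: "norm (a * z) < p"
  shows "pq_Phi10 a b p q z =
         pq_poch_quot (of_real p) (b * z) (of_real p) (a * z) p q N *
           pq_Phi10 a b p q (z * of_real (q / p) ^ N)"
proof (induction N)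
  case 0
  show ?case by (simp add: pq_poch_quot_def pq_poch_def)
next
  case (Suc N)
  define r :: complex where "r = of_real (q / p)"
  have p: "(of_real p :: complex) \<noteq> 0"
    using pq by simp
  let ?w = "z * r ^ N"
  let ?F = "pq_Phi10 a b p q"
  let ?Q = "pq_poch_quot (of_real p) (b * z) (of_real p) (a * z) p q"
  have "norm (r ^ N) \<le> 1"
    using pq by (simp add: r_def norm_divide norm_power power_le_one)
  then have "norm (a * z) * norm (r ^ N) \<le> norm (a * z)"
    by (simp add: mult_left_le)
  then have w: "norm (a * ?w) < p"
    using z by (simp add: norm_mult mult.assoc)
  then have nz: "of_real p - a * ?w \<noteq> 0"
    using pq by (metis abs_of_pos less_irrefl less_trans norm_of_real right_minus_eq)
  have Fw: "?F ?w = (of_real p - b * ?w) / (of_real p - a * ?w) * ?F (z * r ^ Suc N)"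
    using pq_Phi10_functional_eq[OF pq w, of b] nz
    unfolding r_def [symmetric] by (simp add: field_simps)
  \<comment> \<open>The rescaled factor \<open>p - d w\<close> differs from the \<open>N\<close>-th factor of the product by \<open>p\<^sup>N\<close>,
    which cancels in the quotient.\<close>
  have fac: "of_real p * of_real p ^ N - d * z * of_real q ^ N =
      of_real p ^ N * (of_real p - d * ?w)" for d
    using p by (simp add: r_def power_divide field_simps)
  have "?Q (Suc N) = ?Q N * ((of_real p * of_real p ^ N - b * z * of_real q ^ N) /
      (of_real p * of_real p ^ N - a * z * of_real q ^ N))"
    by (simp add: pq_poch_quot_def pq_poch_def)
  also have "\<dots> = ?Q N * ((of_real p - b * ?w) / (of_real p - a * ?w))"
    unfolding fac using p by simp
  finally have "?Q (Suc N) * ?F (z * r ^ Suc N) = ?Q N * ?F ?w"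
    unfolding Fw by (simp only: mult.assoc)
  then show ?case
    using Suc.IH by (simp add: r_def)
qed

lemma isCont_pq_Phi10_0:
  fixes p q :: real
  assumes "0 < q" "q < p"
  shows "isCont (pq_Phi10 a b p q) 0"
proof -
  \<comment> \<open>Any nonzero point of the disc of convergence serves; the summand \<open>1\<close> covers \<open>a = 0\<close>.\<close>
  define K :: complex where "K = of_real (p / (norm a + 1))"
  have pos: "0 < norm a + 1"
    by (rule add_nonneg_pos) simp_all
  have normK: "norm K = p / (norm a + 1)"
    using assms pos by (simp add: K_def norm_divide del: of_real_divide)
  have "norm (a * K) < p"
    using assms pos by (simp add: norm_mult normK field_simps)
  then have "summable (\<lambda>n. pq_coeff a b p q n * K ^ n)"
    by (rule summable_pq_coeff[OF assms])
  moreover have "norm (0 :: complex) < norm K"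
    using assms pos by (simp add: normK)
  ultimately have "isCont (\<lambda>w. \<Sum>n. pq_coeff a b p q n * w ^ n) 0"
    by (rule isCont_powser)
  moreover have "pq_Phi10 a b p q = (\<lambda>w. \<Sum>n. pq_coeff a b p q n * w ^ n)"
    by (simp add: pq_Phi10_def pq_Phi10_term_eq fun_eq_iff)
  ultimately show ?thesis
    by simp
qed

lemma pq_Phi10_0: "pq_Phi10 a b p q 0 = 1"
  by (simp add: pq_Phi10_def pq_Phi10_term_eq powser_zero)

theorem mainTheorem2:
  fixes p q :: real and a b z :: complex
  assumes "0 < q" and "q < p"
    and "a \<noteq> 0" and "b \<noteq> 0"
    and "norm z < 1" and "norm (a * z) < p"
  shows "summable (pq_Phi10_term a b p q z)
       \<and> convergent (pq_poch_quot (of_real p) (b * z) (of_real p) (a * z) p q)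
       \<and> pq_Phi10 a b p q z = pq_poch_inf_quot (of_real p) (b * z) (of_real p) (a * z) p q"
proof -
  let ?F = "pq_Phi10 a b p q"
  let ?Q = "pq_poch_quot (of_real p) (b * z) (of_real p) (a * z) p q"
  let ?w = "\<lambda>N. z * of_real (q / p) ^ N"
  have "norm (of_real (q / p) :: complex) < 1"
    using assms by (simp add: norm_divide)
  then have "?w \<longlonglongrightarrow> z * 0"
    by (intro tendsto_intros LIMSEQ_power_zero)
  then have w: "?w \<longlonglongrightarrow> 0"
    by simp
  have F1: "(\<lambda>N. ?F (?w N)) \<longlonglongrightarrow> 1"
    using isCont_tendsto_compose[OF isCont_pq_Phi10_0[OF assms(1,2)] w, of a b]
    by (simp add: pq_Phi10_0)
  then have lim: "(\<lambda>N. ?F z / ?F (?w N)) \<longlonglongrightarrow> ?F z / 1"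
    by (intro tendsto_intros) simp_all
  have "eventually (\<lambda>N. ?F (?w N) \<noteq> 0) sequentially"
    using F1 by (rule tendsto_imp_eventually_ne) simp
  then have "eventually (\<lambda>N. ?F z / ?F (?w N) = ?Q N) sequentially"
  proof (rule eventually_mono)
    fix N assume "?F (?w N) \<noteq> 0"
    then show "?F z / ?F (?w N) = ?Q N"
      by (subst pq_Phi10_eq_quot_times[OF assms(1,2,6), of b N]) simp
  qed
  then have "?Q \<longlonglongrightarrow> ?F z"
    using lim by (simp add: filterlim_cong)
  moreover have "summable (pq_Phi10_term a b p q z)"
    unfolding pq_Phi10_term_eq using assms(1,2,6) by (rule summable_pq_coeff)
  ultimately show ?thesis
    by (auto simp: pq_poch_inf_quot_def convergent_def dest: limI)
qed

end
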